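(* Let $\mathbf{X}$ be the set of target variables of a Bayesian network with joint distribution $P$, and let $\mathbf{e}$ be evidence on non-target variables. Let $\mathbf{x}_{1:k}$ be an explanation for $\mathbf{e}$, i.e. an instantiation of a nonempty subset $\mathbf{X}_{1:k}\subseteq\mathbf{X}$, and let $\mathbf{y}_{1:m}$ be an instantiation of a nonempty set $\mathbf{Y}_{1:m}\subseteq\mathbf{X}\setminus\mathbf{X}_{1:k}$ of further target variables. Assume that all conditional probabilities and quotients appearing below are well defined (conditioning events have positive probability and denominators are nonzero). If $$CBF(\mathbf{y}_{1:m};\mathbf{e}\mid\mathbf{x}_{1:k})\le\frac{1}{r(\overline{\mathbf{x}_{1:k}};\mathbf{e})},$$ then $$GBF(\mathbf{x}_{1:k}\cup\mathbf{y}_{1:m};\mathbf{e})\le GBF(\mathbf{x}_{1:k};\mathbf{e}).$$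
   Context: A Bayesian network here is a finite collection of discrete random variables with joint distribution $P$; only $P$ matters. A partial instantiation $\mathbf{x}_{1:k}$ (an assignment of values to the variables in $\mathbf{X}_{1:k}$) is identified with the event $\{\mathbf{X}_{1:k}=\mathbf{x}_{1:k}\}$, and similarly $\mathbf{y}_{1:m}$ with the event $\{\mathbf{Y}_{1:m}=\mathbf{y}_{1:m}\}$ and the evidence $\mathbf{e}$ with the event $\{\mathbf{E}=\mathbf{e}\}$, where $\mathbf{E}$ is the set of evidence variables, disjoint from $\mathbf{X}$. The union $\mathbf{x}_{1:k}\cup\mathbf{y}_{1:m}$ is the combined instantiation, i.e. the conjunction (intersection) of the two events. An overline denotes the alternative explanations, i.e. the complementary event: $\overline{\mathbf{x}_{1:k}}=\{\mathbf{X}_{1:k}\ne\mathbf{x}_{1:k}\}$, so $P(\overline{\mathbf{x}_{1:k}})=1-P(\mathbf{x}_{1:k})$. Definitions. For an event $\mathbf{h}$ given by an explanation or its complement: - Belief update ratio: $r(\mathbf{h};\mathbf{e})=\dfrac{P(\mathbf{h}\mid\mathbf{e})}{P(\mathbf{h})}$. - Generalized Bayes factor: $GBF(\mathbf{h};\mathbf{e})=\dfrac{P(\mathbf{e}\mid\mathbf{h})}{P(\mathbf{e}\mid\overline{\mathbf{h}})}$. - Conditional Bayes factor: $CBF(\mathbf{y}_{1:m};\mathbf{e}\mid\mathbf{x}_{1:k})=\dfrac{P(\mathbf{e}\mid\mathbf{y}_{1:m},\mathbf{x}_{1:k})}{P(\mathbf{e}\mid\overline{\mathbf{y}_{1:m}},\mathbf{x}_{1:k})}$.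 *)

theory Defs
  imports "HOL-Probability.Probability"
begin

(* Only the joint distribution of a Bayesian network is modelled, as a pmf on full
   instantiations: V is the set of variables and Val v the set of values of v.  A full
   instantiation is an element of the extensional product of the sets Val v. *)
definition bayes_net :: "'v set \<Rightarrow> ('v \<Rightarrow> 'a set) \<Rightarrow> ('v \<Rightarrow> 'a) pmf \<Rightarrow> bool" where
  "bayes_net V Val P \<longleftrightarrow> finite V \<and> set_pmf P \<subseteq> (\<Pi>\<^sub>E v\<in>V. Val v)"

definition instantiation_of :: "('v \<Rightarrow> 'a set) \<Rightarrow> 'v set \<Rightarrow> ('v \<rightharpoonup> 'a) \<Rightarrow> bool" where
  "instantiation_of Val S x \<longleftrightarrow> dom x = S \<and> (\<forall>v a. x v = Some a \<longrightarrow> a \<in> Val v)"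

definition event_of :: "('v \<rightharpoonup> 'a) \<Rightarrow> ('v \<Rightarrow> 'a) set" where
  "event_of x = {w. \<forall>v\<in>dom x. x v = Some (w v)}"

abbreviation Pr :: "'w pmf \<Rightarrow> 'w set \<Rightarrow> real" where
  "Pr P A \<equiv> measure_pmf.prob P A"

(* Pr_given P A B is P(A | B), the library's conditional probability with the two events
   given as sets; like every quotient below, it is 0 when its denominator is 0. *)
abbreviation Pr_given :: "'w pmf \<Rightarrow> 'w set \<Rightarrow> 'w set \<Rightarrow> real" where
  "Pr_given P A B \<equiv> cond_prob (measure_pmf P) (\<lambda>w. w \<in> A) (\<lambda>w. w \<in> B)"

(* The measures of explanation below take events.  The alternative explanations to an
   event h form its complement - h. *)
definition belief_update_ratio :: "'w pmf \<Rightarrow> 'w set \<Rightarrow> 'w set \<Rightarrow> real" where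
  "belief_update_ratio P h e = Pr_given P h e / Pr P h"

definition GBF :: "'w pmf \<Rightarrow> 'w set \<Rightarrow> 'w set \<Rightarrow> real" where
  "GBF P h e = Pr_given P e h / Pr_given P e (- h)"

(* CBF P y e x is CBF(y; e | x). *)
definition CBF :: "'w pmf \<Rightarrow> 'w set \<Rightarrow> 'w set \<Rightarrow> 'w set \<Rightarrow> real" where
  "CBF P y e x = Pr_given P e (y \<inter> x) / Pr_given P e (- y \<inter> x)"

end

(* Write a, b, c for the probabilities of x \<and> y, x \<and> \<not>y, \<not>x and p, q, r for the conditional
   probabilities of e given them.  Then P(e) = a p + b q + c r, so the assumption reads
   p r \<le> q (a p + b q + c r), and after clearing denominators the claim reads
   p r (a + b) (b + c) \<le> (a p + b q) (b q + c r).  Since a + b + c = 1, the left side is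
   p r (b + a c), while the right side is b q P(e) + a c p r; the claim is thus b times the
   assumption. *)

theory Submission
  imports Defs
begin

text \<open>The nested quotients are weighted means: the complement of x \<and> y consists of the
  cells of weights b and c, so e has there the mean of q and r; x consists of the cells of weights a
  and b, so e has there the mean of p and q.\<close>

lemma mixture_ratio_le:
  fixes a b c p q r :: real
  assumes "a > 0" "b > 0" "c > 0" "a + b + c = 1" "q > 0" "r > 0"
    and le: "p / q \<le> (a * p + b * q + c * r) / r"
  shows "p / ((b * q + c * r) / (b + c)) \<le> ((a * p + b * q) / (a + b)) / r"
proof -
  have "p * r \<le> q * (a * p + b * q + c * r)"
    using le assms(5,6) by (simp add: field_simps)
  then have b_le: "b * (p * r) \<le> b * (q * (a * p + b * q + c * r))"
    using \<open>b > 0\<close> by simp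
  have "(a + b) * (b + c) = b * (a + b + c) + a * c"
    by algebra
  then have "p * (b + c) * ((a + b) * r) = b * (p * r) + a * c * (p * r)"
    using \<open>a + b + c = 1\<close> by algebra
  also have "\<dots> \<le> b * (q * (a * p + b * q + c * r)) + a * c * (p * r)"
    using b_le by simp
  also have "\<dots> = (a * p + b * q) * (b * q + c * r)"
    by algebra
  finally have "p * (b + c) * ((a + b) * r) \<le> (a * p + b * q) * (b * q + c * r)" .
  moreover have "b * q + c * r > 0" "(a + b) * r > 0"
    using assms(1-6) by (simp_all add: add_pos_pos)
  ultimately have "p * (b + c) / (b * q + c * r) \<le> (a * p + b * q) / ((a + b) * r)"
    by (metis pos_divide_le_eq pos_le_divide_eq times_divide_eq_left)
  then show ?thesis
    by simp
qed

lemma Pr_given_eq: "Pr_given P A B = Pr P (A \<inter> B) / Pr P B"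
  by (simp add: cond_prob_def Int_def)

lemma Pr_given_mult: "Pr P B > 0 \<Longrightarrow> Pr P B * Pr_given P A B = Pr P (A \<inter> B)"
  by (simp add: Pr_given_eq)

lemma Pr_split: "Pr P A = Pr P (A \<inter> B) + Pr P (A \<inter> - B)"
proof -
  have "A = A \<inter> B \<union> A \<inter> - B" by blast
  then show ?thesis
    using measure_pmf.finite_measure_Union[of "A \<inter> B" P "A \<inter> - B"] by auto
qed

text \<open>The three events \<open>y \<inter> x\<close>, \<open>- y \<inter> x\<close> and
  \<open>- x\<close> partition the space, so every probability involved is a sum over these cells.
  This turns the claim on arbitrary events into \<open>mixture_ratio_le\<close>.\<close>

lemma GBF_Int_le:
  assumes pos: "Pr P e > 0" "Pr P (- x) > 0" "Pr P (y \<inter> x) > 0" "Pr P (- y \<inter> x) > 0"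
    and nonzero: "Pr_given P e (- y \<inter> x) \<noteq> 0" "Pr_given P e (- x) \<noteq> 0"
    and le: "CBF P y e x \<le> 1 / belief_update_ratio P (- x) e"
  shows "GBF P (y \<inter> x) e \<le> GBF P x e"
proof -
  define a b c where "a = Pr P (y \<inter> x)" and "b = Pr P (- y \<inter> x)" and "c = Pr P (- x)"
  define p q r where "p = Pr_given P e (y \<inter> x)" and "q = Pr_given P e (- y \<inter> x)"
    and "r = Pr_given P e (- x)"
  have abc: "a > 0" "b > 0" "c > 0"
    using pos by (simp_all add: a_def b_def c_def)
  have qr: "q > 0" "r > 0"
    using nonzero by (simp_all add: q_def r_def cond_prob_def less_le)
  have e_yx: "Pr P (e \<inter> (y \<inter> x)) = a * p" and e_nyx: "Pr P (e \<inter> (- y \<inter> x)) = b * q"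
    and e_nx: "Pr P (e \<inter> - x) = c * r"
    unfolding a_def b_def c_def p_def q_def r_def
    by (rule Pr_given_mult[symmetric], fact)+
  have x: "Pr P x = a + b"
    using Pr_split[of P x y] by (simp add: a_def b_def Int_commute)
  have total: "a + b + c = 1"
    using Pr_split[of P UNIV x] x measure_pmf.prob_space[of P] by (simp add: c_def)
  have e_x: "Pr P (e \<inter> x) = a * p + b * q"
    using Pr_split[of P "e \<inter> x" y] e_yx e_nyx by (simp add: Int_ac)
  have e: "Pr P e = a * p + b * q + c * r"
    using Pr_split[of P e x] e_x e_nx by simp
  \<comment> \<open>The two probabilities involving the complement of \<open>y \<inter> x\<close>
    come by subtracting the cell \<open>y \<inter> x\<close> from the whole space and from
    \<open>e\<close>.\<close>
  have nyx: "Pr P (- (y \<inter> x)) = b + c"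
    using Pr_split[of P UNIV "y \<inter> x"] total measure_pmf.prob_space[of P] by (simp add: a_def)
  have e_nyx': "Pr P (e \<inter> - (y \<inter> x)) = b * q + c * r"
    using Pr_split[of P e "y \<inter> x"] e e_yx by simp
  \<comment> \<open>By the symmetry of Bayes' rule, P(\<not>x | e) / P(\<not>x) = P(e | \<not>x) /
    P(e): the factor c cancels.\<close>
  have "belief_update_ratio P (- x) e = r / (a * p + b * q + c * r)"
    unfolding belief_update_ratio_def Pr_given_eq[of P "- x" e] Int_commute[of "- x" e]
      c_def[symmetric] e_nx e using abc by simp
  then have "p / q \<le> (a * p + b * q + c * r) / r"
    using le by (simp add: CBF_def p_def q_def)
  \<comment> \<open>Only the conditional probabilities given \<open>x\<close> and given
    \<open>- (y \<inter> x)\<close> mix two cells. They are expanded into quotients, while p and r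
    stay folded.\<close>
  from mixture_ratio_le[OF abc total qr this] show ?thesis
    unfolding GBF_def Pr_given_eq[of P e "- (y \<inter> x)"] Pr_given_eq[of P e x]
      e_nyx' nyx e_x x p_def[symmetric] r_def[symmetric] .
qed

text \<open>Where both maps are defined, \<open>++\<close> keeps the value of \<open>y\<close> and
  would lose the constraint set by \<open>x\<close>; disjoint domains exclude this. The order of the
  intersection is that of the conditioning event in \<open>CBF\<close>.\<close>

lemma event_of_map_add:
  assumes "dom x \<inter> dom y = {}"
  shows "event_of (x ++ y) = event_of y \<inter> event_of x"
proof -
  have "x v = (x ++ y) v" if "v \<in> dom x" for v
    using assms that by (simp add: map_add_dom_app_simps(3) disjoint_iff)
  moreover have "y v = (x ++ y) v" if "v \<in> dom y" for v
    using that by (simp add: map_add_dom_app_simps(1))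
  ultimately have "(\<forall>v\<in>dom (x ++ y). (x ++ y) v = Some (w v)) \<longleftrightarrow>
    (\<forall>v\<in>dom y. y v = Some (w v)) \<and> (\<forall>v\<in>dom x. x v = Some (w v))" for w
    unfolding dom_map_add by (metis UnCI UnE)
  then show ?thesis
    by (auto simp only: event_of_def Int_iff mem_Collect_eq set_eq_iff)
qed

theorem theorem1:
  fixes V X X1 Y1 E :: "'v set"
    and Val :: "'v \<Rightarrow> 'a set"
    and P :: "('v \<Rightarrow> 'a) pmf"
    and x y e :: "'v \<rightharpoonup> 'a"
  assumes net: "bayes_net V Val P"
    and targets: "X \<subseteq> V"
    and evidence: "E \<subseteq> V - X" "instantiation_of Val E e"
    and expl_x: "X1 \<subseteq> X" "X1 \<noteq> {}" "instantiation_of Val X1 x"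
    and expl_y: "Y1 \<subseteq> X - X1" "Y1 \<noteq> {}" "instantiation_of Val Y1 y"
    and conditioning_positive:
      "Pr P (event_of e) > 0"
      "Pr P (event_of x) > 0"
      "Pr P (- event_of x) > 0"
      "Pr P (event_of y \<inter> event_of x) > 0"
      "Pr P (- event_of y \<inter> event_of x) > 0"
      "Pr P (event_of (x ++ y)) > 0"
      "Pr P (- event_of (x ++ y)) > 0"
    and denominators_nonzero:
      "Pr_given P (event_of e) (- event_of y \<inter> event_of x) \<noteq> 0"
      "belief_update_ratio P (- event_of x) (event_of e) \<noteq> 0"
      "Pr_given P (event_of e) (- event_of x) \<noteq> 0"
      "Pr_given P (event_of e) (- event_of (x ++ y)) \<noteq> 0"
    and CBF_le:
      "CBF P (event_of y) (event_of e) (event_of x)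
        \<le> 1 / belief_update_ratio P (- event_of x) (event_of e)"
  shows "GBF P (event_of (x ++ y)) (event_of e) \<le> GBF P (event_of x) (event_of e)"
proof -
  \<comment> \<open>The domains are \<open>X1\<close> and \<open>Y1\<close>, and \<open>Y1\<close>
    is chosen outside \<open>X1\<close>.\<close>
  have "dom x \<inter> dom y = {}"
    using expl_x(3) expl_y(1,3) by (auto simp: instantiation_of_def)
  then have "event_of (x ++ y) = event_of y \<inter> event_of x"
    by (rule event_of_map_add)
  then show ?thesis
    using GBF_Int_le[OF conditioning_positive(1,3,4,5) denominators_nonzero(1,3) CBF_le] by simp
qed

end
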